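(* Let $\langle F,E\rangle$ be an anti-dual pair and let $\mathcal H_1,\mathcal H_2$ be Hilbert spaces. Given two weakly continuous linear operators $T_j\in\mathscr L(\mathcal H_j,F)$ ($j=1,2$), the following assertions are equivalent: (i) $\operatorname{ran}T_1\subseteq\operatorname{ran}T_2$; (ii) there is a constant $\alpha\ge 0$ such that $\|T_1^*x\|^2\le\alpha\|T_2^*x\|^2$ for all $x\in E$; (iii) for every $h_1\in\mathcal H_1$ there is a constant $\alpha_{h_1}\ge0$ such that $|\langle T_1h_1,x\rangle|^2\le\alpha_{h_1}\|T_2^*x\|^2$ for all $x\in E$; (iv) there is a bounded operator $D:\mathcal H_1\to\mathcal H_2$ such that $T_1=T_2D$. Moreover, if any (hence all) of (i)-(iv) is valid, then there is a unique bounded operator $D:\mathcal H_1\to\mathcal H_2$ with $T_1=T_2D$ such that (a) $\operatorname{ran}D\subseteq(\ker T_2)^\perp$, (b) $\ker T_1=\ker D$, (c) $\|D\|^2=\inf\{\alpha\ge0:\|T_1^*x\|^2\le\alpha\|T_2^*x\|^2\ \text{for all }x\in E\}$.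
   Context: An anti-dual pair $\langle F,E\rangle$ consists of complex vector spaces $E,F$ and a map $\langle\cdot,\cdot\rangle:F\times E\to\mathbb C$, linear in the first and conjugate linear in the second variable, that separates the points of $E$ and of $F$. $\sigma(F,E)$ is the weak topology on $F$ induced by the functionals $\langle\cdot,x\rangle$ ($x\in E$), and $\sigma(E,F)$ is the weak topology on $E$ induced by the functionals $\langle f,\cdot\rangle$ ($f\in F$). For a Hilbert space $\mathcal H$ with inner product $(\cdot\,|\,\cdot)$ (linear in the first variable), $\mathscr L(\mathcal H,F)$ denotes the set of linear operators $T:\mathcal H\to F$ that are continuous from the weak topology of $\mathcal H$ to $\sigma(F,E)$. The adjoint $T^*:E\to\mathcal H$ of such a $T$ is the linear operator (continuous from $\sigma(E,F)$ to the weak topology of $\mathcal H$) determined by $\langle Th,x\rangle=(h\,|\,T^*x)$ for all $h\in\mathcal H$, $x\in E$. *)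

theory Defs
  imports "HOL-Analysis.Analysis"
begin

section \<open>Complex vector spaces and complex Hilbert spaces\<close>

class complex_vector = ab_group_add +
  fixes scaleC :: "complex \<Rightarrow> 'a \<Rightarrow> 'a"  (infixr \<open>*\<^sub>C\<close> 75)
  assumes scaleC_add_right: "a *\<^sub>C (x + y) = a *\<^sub>C x + a *\<^sub>C y"
    and scaleC_add_left: "(a + b) *\<^sub>C x = a *\<^sub>C x + b *\<^sub>C x"
    and scaleC_scaleC: "a *\<^sub>C b *\<^sub>C x = (a * b) *\<^sub>C x"
    and scaleC_one: "1 *\<^sub>C x = x"

text \<open>
  The inner product is linear in the first variable.  The real normed structure of the library is
  tied to it: \<open>scaleR\<close> is the restriction of \<open>scaleC\<close> to the reals, and the norm is the one induced
  by the inner product.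
\<close>

class complex_inner = complex_vector + real_normed_vector +
  fixes cinner :: "'a \<Rightarrow> 'a \<Rightarrow> complex"
  assumes scaleR_scaleC: "r *\<^sub>R x = complex_of_real r *\<^sub>C x"
    and cinner_commute: "cinner x y = cnj (cinner y x)"
    and cinner_add_left: "cinner (x + y) z = cinner x z + cinner y z"
    and cinner_scaleC_left: "cinner (a *\<^sub>C x) y = a * cinner x y"
    and cinner_ge_zero: "0 \<le> Re (cinner x x)"
    and cinner_eq_zero_iff: "cinner x x = 0 \<longleftrightarrow> x = 0"
    and norm_eq_sqrt_cinner: "norm x = sqrt (Re (cinner x x))"

class chilbert_space = complex_inner + banach

instantiation complex :: chilbert_space
begin

definition scaleC_complex :: "complex \<Rightarrow> complex \<Rightarrow> complex" where
  "scaleC_complex a x = a * x"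

definition cinner_complex :: "complex \<Rightarrow> complex \<Rightarrow> complex" where
  "cinner_complex x y = x * cnj y"

instance
  by standard
    (simp_all add: scaleC_complex_def cinner_complex_def algebra_simps scaleR_conv_of_real
      cmod_def power2_eq_square)

end

lemma vector_space_scaleC: "vector_space (scaleC :: complex \<Rightarrow> 'a::complex_vector \<Rightarrow> 'a)"
  by unfold_locales (simp_all add: scaleC_add_right scaleC_add_left scaleC_scaleC scaleC_one)


section \<open>Linear operators\<close>

abbreviation clinear :: "('a::complex_vector \<Rightarrow> 'b::complex_vector) \<Rightarrow> bool" where
  "clinear \<equiv> Vector_Spaces.linear scaleC scaleC"

text \<open>The operator norm of a bounded operator is \<^const>\<open>onorm\<close>.\<close>

definition bounded_clinear ::
  "('a::{complex_vector, real_normed_vector} \<Rightarrow> 'b::{complex_vector, real_normed_vector}) \<Rightarrow> bool"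
  where "bounded_clinear T \<longleftrightarrow> clinear T \<and> (\<exists>K. \<forall>h. norm (T h) \<le> K * norm h)"

definition ker :: "('a \<Rightarrow> 'b::zero) \<Rightarrow> 'a set" where
  "ker T = {h. T h = 0}"

definition ortho_compl :: "'a::complex_inner set \<Rightarrow> 'a set" where
  "ortho_compl S = {h. \<forall>k\<in>S. cinner h k = 0}"


section \<open>Anti-dual pairs and weak topologies\<close>

locale anti_dual_pair =
  fixes pair :: "'f::complex_vector \<Rightarrow> 'e::complex_vector \<Rightarrow> complex"
  assumes add_left: "pair (f + g) x = pair f x + pair g x"
    and scaleC_left: "pair (a *\<^sub>C f) x = a * pair f x"
    and add_right: "pair f (x + y) = pair f x + pair f y"
    and scaleC_right: "pair f (a *\<^sub>C x) = cnj a * pair f x"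
    and separates_left: "f \<noteq> g \<Longrightarrow> \<exists>x. pair f x \<noteq> pair g x"
    and separates_right: "x \<noteq> y \<Longrightarrow> \<exists>f. pair f x \<noteq> pair f y"

text \<open>The coarsest topology making all functionals of the (nonempty) family \<open>\<Phi>\<close> continuous.\<close>

definition induced_topology :: "('a \<Rightarrow> complex) set \<Rightarrow> 'a topology" where
  "induced_topology \<Phi> = topology_generated_by {\<phi> -` U | \<phi> U. \<phi> \<in> \<Phi> \<and> open U}"

text \<open>The topology \<open>\<sigma>(F,E)\<close> on \<open>F\<close>.\<close>

definition sigma_left :: "('f \<Rightarrow> 'e \<Rightarrow> complex) \<Rightarrow> 'f topology" where
  "sigma_left pair = induced_topology (range (\<lambda>x f. pair f x))"

definition weak_topology :: "'h::{complex_vector, real_normed_vector} topology" where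
  "weak_topology = induced_topology {\<phi>. bounded_clinear \<phi>}"

text \<open>The space \<open>\<L>(H,F)\<close>.\<close>

definition weak_operators ::
  "('f::complex_vector \<Rightarrow> 'e \<Rightarrow> complex) \<Rightarrow> ('h::chilbert_space \<Rightarrow> 'f) set" where
  "weak_operators pair = {T. clinear T \<and> continuous_map weak_topology (sigma_left pair) T}"

text \<open>
  The adjoint of a weakly continuous operator.  There is at most one map satisfying the identity
  (see below); its existence for \<open>T \<in> weak_operators pair\<close> is an application of the Riesz
  representation theorem to the functionals \<open>\<lambda>h. pair (T h) x\<close>.
\<close>

definition weak_adjoint ::
  "('f \<Rightarrow> 'e::complex_vector \<Rightarrow> complex) \<Rightarrow> ('h::chilbert_space \<Rightarrow> 'f) \<Rightarrow> 'e \<Rightarrow> 'h" where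
  "weak_adjoint pair T = (THE S. clinear S \<and> (\<forall>h x. pair (T h) x = cinner h (S x)))"

lemma weak_adjoint_eqI:
  assumes "clinear S" and S: "\<And>h x. pair (T h) x = cinner h (S x)"
  shows "weak_adjoint pair T = S"
  unfolding weak_adjoint_def
proof (rule the_equality)
  show "clinear S \<and> (\<forall>h x. pair (T h) x = cinner h (S x))"
    using assms by blast
next
  fix S' assume S': "clinear S' \<and> (\<forall>h x. pair (T h) x = cinner h (S' x))"
  show "S' = S"
  proof
    fix x
    let ?d = "S' x - S x"
    have eq: "cinner h (S' x) = cinner h (S x)" for h
      using S S' by metis
    have "cinner ?d h = cinner (S' x) h - cinner (S x) h" for h
      using cinner_add_left[of ?d "S x" h] by simp
    moreover have "cinner (S' x) h = cinner (S x) h" for h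
      by (metis eq cinner_commute)
    ultimately have "cinner ?d ?d = 0" by simp
    then show "S' x = S x" by (simp add: cinner_eq_zero_iff)
  qed
qed

end

theory Submission
  imports Defs
begin

text \<open>
  If \<open>|\<langle>f,x\<rangle>|\<close> is dominated by \<open>C \<parallel>T\<^sup>* x\<parallel>\<close>, a Riesz type argument gives \<open>h\<close> in the closure of
  \<open>ran T\<^sup>*\<close>, hence in \<open>(ker T)\<^sup>\<bottom>\<close>, with \<open>T h = f\<close> and \<open>\<parallel>h\<parallel> \<le> C\<close>.  The range inclusion yields
  the pointwise bounds (iii) by Cauchy--Schwarz; the uniform boundedness principle, applied to the
  functionals \<open>(\<cdot> | r T\<^sub>1\<^sup>* x)\<close> with \<open>r \<parallel>T\<^sub>2\<^sup>* x\<parallel> \<le> 1\<close>, makes them uniform as in (ii).  Then \<open>D h\<close> is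
  the unique preimage of \<open>T\<^sub>1 h\<close> under \<open>T\<^sub>2\<close> in \<open>(ker T\<^sub>2)\<^sup>\<bottom>\<close>, and \<open>\<parallel>D\<parallel>\<^sup>2\<close> is the least admissible
  constant.
\<close>

section \<open>The uniform boundedness principle\<close>

text \<open>Baire category: the closed sets \<open>S n\<close>, where the whole family is bounded by
  \<open>n\<close>, cover the Banach space, so one of them contains a ball; linearity carries the
  bound on that ball to the origin.\<close>

lemma uniform_boundedness:
  fixes \<F> :: "('a::banach \<Rightarrow> 'b::real_normed_vector) set"
  assumes lin: "\<And>f. f \<in> \<F> \<Longrightarrow> bounded_linear f"
    and pointwise: "\<And>x. \<exists>C. \<forall>f\<in>\<F>. norm (f x) \<le> C"
  obtains C where "C \<ge> 0" "\<And>f x. f \<in> \<F> \<Longrightarrow> norm (f x) \<le> C * norm x"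
proof -
  define S where "S n = {x. \<forall>f\<in>\<F>. norm (f x) \<le> real n}" for n
  have "closed (S n)" for n
  proof -
    have "S n = (\<Inter>f\<in>\<F>. {x. norm (f x) \<le> real n})"
      by (auto simp: S_def)
    moreover have "closed {x. norm (f x) \<le> real n}" if "f \<in> \<F>" for f
      by (intro closed_Collect_le continuous_intros linear_continuous_on lin that)
    ultimately show ?thesis by auto
  qed
  moreover have "(\<Union>n. S n) = UNIV"
  proof -
    have "\<exists>n. x \<in> S n" for x
    proof -
      obtain C where "\<forall>f\<in>\<F>. norm (f x) \<le> C"
        using pointwise by blast
      then have "x \<in> S (nat \<lceil>C\<rceil>)"
        unfolding S_def using real_nat_ceiling_ge[of C] order_trans by blast
      then show ?thesis by blast
    qed
    then show ?thesis by auto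
  qed
  ultimately obtain n where "interior (S n) \<noteq> {}"
    using Met_TC.metric_Baire_category_alt[of "range S"] complete_UNIV by auto
  then obtain x0 r where r: "r > 0" and ball: "cball x0 r \<subseteq> S n"
    by (meson equals0I mem_interior_cball)
  have "norm (f x) \<le> 2 * real n / r * norm x" if f: "f \<in> \<F>" for f x
  proof (cases "x = 0")
    case True
    then show ?thesis
      using bounded_linear.linear[OF lin[OF f]] by (simp add: linear_0)
  next
    case False
    \<comment> \<open>With \<open>t = r / norm x\<close> both \<open>x0\<close> and
      \<open>x0 + t *\<^sub>R x\<close> lie in the ball. The images differ by
      \<open>t *\<^sub>R f x\<close>, of norm at most \<open>2 * n\<close>, whence the constant
      \<open>2 * n / r\<close>.\<close>
    interpret f: bounded_linear f by (rule lin[OF f])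
    define t where "t = r / norm x"
    have t: "t > 0" using r False by (simp add: t_def)
    have "x0 \<in> S n" "x0 + t *\<^sub>R x \<in> S n"
      using ball r False by (auto simp: t_def dist_norm subset_iff)
    then have "norm (f x0) \<le> n" "norm (f (x0 + t *\<^sub>R x)) \<le> n"
      using f by (auto simp: S_def)
    then have "norm (f (x0 + t *\<^sub>R x) - f x0) \<le> 2 * real n"
      by (smt (verit) norm_triangle_ineq4)
    then have "t * norm (f x) \<le> 2 * real n"
      using t by (simp add: f.add f.scaleR)
    then show ?thesis
      using r False by (simp add: t_def field_simps)
  qed
  then show ?thesis
    using that[of "2 * real n / r"] r by auto
qed

section \<open>Geometry of complex inner product spaces\<close>

context complex_inner
begin

lemma cinner_add_right: "cinner x (y + z) = cinner x y + cinner x z"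
  by (metis cinner_add_left cinner_commute complex_cnj_add)

lemma cinner_scaleC_right: "cinner x (a *\<^sub>C y) = cnj a * cinner x y"
  by (metis cinner_scaleC_left cinner_commute complex_cnj_mult)

lemma cinner_zero_left [simp]: "cinner 0 x = 0"
  using cinner_add_left[of 0 0 x] by simp

lemma cinner_zero_right [simp]: "cinner x 0 = 0"
  using cinner_add_right[of x 0 0] by simp

lemma cinner_diff_left: "cinner (x - y) z = cinner x z - cinner y z"
  using cinner_add_left[of "x - y" y z] by simp

lemma cinner_diff_right: "cinner x (y - z) = cinner x y - cinner x z"
  using cinner_add_right[of x "y - z" z] by simp

lemma cinner_self: "cinner x x = complex_of_real ((norm x)\<^sup>2)"
proof (rule complex_eqI)
  show "Re (cinner x x) = Re (complex_of_real ((norm x)\<^sup>2))"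
    using cinner_ge_zero[of x] by (simp add: norm_eq_sqrt_cinner)
  show "Im (cinner x x) = Im (complex_of_real ((norm x)\<^sup>2))"
    using arg_cong[OF cinner_commute[of x x], of Im] by simp
qed

lemma norm_add_sqr: "(norm (x + y))\<^sup>2 = (norm x)\<^sup>2 + 2 * Re (cinner x y) + (norm y)\<^sup>2"
proof -
  have "Re (cinner (x + y) (x + y)) = Re (cinner x x) + 2 * Re (cinner x y) + Re (cinner y y)"
    using arg_cong[OF cinner_commute[of y x], of Re] by (simp add: cinner_add_left cinner_add_right)
  then show ?thesis by (simp add: cinner_self)
qed

lemma norm_scaleC: "norm (a *\<^sub>C x) = cmod a * norm x"
proof -
  have "cinner (a *\<^sub>C x) (a *\<^sub>C x) = a * cnj a * cinner x x"
    by (simp add: cinner_scaleC_left cinner_scaleC_right)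
  also have "\<dots> = complex_of_real ((cmod a * norm x)\<^sup>2)"
    by (simp add: cinner_self power_mult_distrib flip: complex_norm_square)
  finally have "cinner (a *\<^sub>C x) (a *\<^sub>C x) = complex_of_real ((cmod a * norm x)\<^sup>2)" .
  then have "(norm (a *\<^sub>C x))\<^sup>2 = (cmod a * norm x)\<^sup>2"
    by (metis cinner_self of_real_eq_iff)
  then show ?thesis by (simp add: power2_eq_iff_nonneg)
qed

lemma parallelogram: "(norm (x - y))\<^sup>2 = 2 * (norm x)\<^sup>2 + 2 * (norm y)\<^sup>2 - (norm (x + y))\<^sup>2"
proof -
  have "cinner x (- y) = - cinner x y"
    using cinner_diff_right[of x 0 y] by simp
  then show ?thesis
    using norm_add_sqr[of x y] norm_add_sqr[of x "- y"] by simp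
qed

text \<open>For nonzero \<open>y\<close> the vector \<open>a *\<^sub>C y\<close> is the orthogonal
  projection of \<open>x\<close> onto the line of \<open>y\<close>; by Pythagoras it is no longer
  than \<open>x\<close>, and its length is \<open>cmod (cinner x y) / norm y\<close>.\<close>

lemma cinner_cauchy_schwarz: "cmod (cinner x y) \<le> norm x * norm y"
proof (cases "y = 0")
  case False
  define a where "a = cinner x y / complex_of_real ((norm y)\<^sup>2)"
  have ny: "norm y > 0" using False by simp
  have "cinner (x - a *\<^sub>C y) y = 0"
    using False by (simp add: a_def cinner_diff_left cinner_scaleC_left cinner_self)
  then have "Re (cinner (x - a *\<^sub>C y) (a *\<^sub>C y)) = 0"
    by (simp add: cinner_scaleC_right)
  then have "(norm x)\<^sup>2 = (norm (x - a *\<^sub>C y))\<^sup>2 + (norm (a *\<^sub>C y))\<^sup>2"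
    using norm_add_sqr[of "x - a *\<^sub>C y" "a *\<^sub>C y"] by simp
  then have "norm (a *\<^sub>C y) \<le> norm x"
    by (simp add: power2_le_imp_le)
  then show ?thesis
    using ny by (simp add: norm_scaleC a_def norm_divide norm_power power2_eq_square norm_mult field_simps)
qed simp

end

lemma bounded_linear_cinner_left: "bounded_linear (\<lambda>x::'a::complex_inner. cinner x y)"
  by (rule bounded_linear_intro[where K = "norm y"])
    (simp_all add: cinner_add_left cinner_scaleC_left scaleR_scaleC cinner_cauchy_schwarz
      scaleC_complex_def)

lemma bounded_linear_cinner_right: "bounded_linear (\<lambda>y::'a::complex_inner. cinner x y)"
  by (rule bounded_linear_intro[where K = "norm x"])
    (simp_all add: cinner_add_right cinner_scaleC_right scaleR_scaleC scaleC_complex_def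
      mult.commute[of "norm _" "norm x"] cinner_cauchy_schwarz)

lemmas tendsto_cinner_left = bounded_linear.tendsto[OF bounded_linear_cinner_left]
lemmas tendsto_cinner_right = bounded_linear.tendsto[OF bounded_linear_cinner_right]

section \<open>Linearity and boundedness\<close>

lemma clinear_iff:
  "clinear f \<longleftrightarrow> (\<forall>x y. f (x + y) = f x + f y) \<and> (\<forall>a x. f (a *\<^sub>C x) = a *\<^sub>C f x)"
  by (simp add: Vector_Spaces.linear_iff vector_space_scaleC)

text \<open>Rescaling a nonzero vector to norm \<open>d / 2\<close> puts it inside the open ball of
  radius \<open>d\<close>, where \<open>f\<close> stays below 1; this gives the constant
  \<open>2 / d\<close>.\<close>

lemma bounded_linear_if_continuous_at_0:
  assumes "linear f" and "continuous (at 0) f"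
  shows "bounded_linear f"
proof -
  interpret linear f by fact
  obtain d where d: "d > 0" and small: "\<And>x. norm x < d \<Longrightarrow> norm (f x) < 1"
    using assms(2) unfolding continuous_at_eps_delta by (metis diff_zero zero zero_less_one dist_norm)
  have "norm (f x) \<le> norm x * (2 / d)" for x
  proof (cases "x = 0")
    case False
    define t where "t = d / (2 * norm x)"
    have t: "t > 0" using d False by (simp add: t_def)
    have "norm (t *\<^sub>R x) < d" using d False by (simp add: t_def)
    then have "t * norm (f x) < 1"
      using small[of "t *\<^sub>R x"] t by (simp add: scale)
    then show ?thesis using d False by (simp add: t_def field_simps)
  qed (simp add: zero)
  then show ?thesis
    by (intro bounded_linear_intro[where K = "2 / d"]) (simp_all add: add scale)
qed

lemma bounded_clinear_imp_bounded_linear: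
  fixes T :: "'a::complex_inner \<Rightarrow> 'b::complex_inner"
  assumes "bounded_clinear T"
  shows "bounded_linear T"
proof -
  obtain K where "\<And>h. norm (T h) \<le> K * norm h"
    using assms by (auto simp: bounded_clinear_def)
  moreover have "clinear T" using assms by (simp add: bounded_clinear_def)
  ultimately show ?thesis
    by (intro bounded_linear_intro[where K = K])
      (auto simp: clinear_iff scaleR_scaleC mult.commute)
qed

text \<open>A minimising sequence for \<open>\<parallel>A x\<parallel>\<^sup>2 - 2 Re (\<phi> x)\<close> has Cauchy images under \<open>A\<close> by the
  parallelogram law; their limit represents \<open>\<phi>\<close> because the first variation vanishes.\<close>

lemma riesz_along_operator:
  fixes A :: "'e::complex_vector \<Rightarrow> 'h::chilbert_space" and \<phi> :: "'e \<Rightarrow> complex"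
  assumes A: "clinear A" and \<phi>: "clinear \<phi>"
    and C: "\<And>x. cmod (\<phi> x) \<le> C * norm (A x)"
  obtains h where "h \<in> closure (range A)" "\<And>x. \<phi> x = cinner (A x) h" "norm h \<le> \<bar>C\<bar>"
proof -
  have A_add: "A (x + y) = A x + A y" and A_scale: "A (a *\<^sub>C x) = a *\<^sub>C A x" for a x y
    using A by (auto simp: clinear_iff)
  have \<phi>_add: "\<phi> (x + y) = \<phi> x + \<phi> y" and \<phi>_scale: "\<phi> (a *\<^sub>C x) = a * \<phi> x" for a x y
    using \<phi> by (auto simp: clinear_iff scaleC_complex_def)
  \<comment> \<open>If \<open>h\<close> represents \<open>\<phi>\<close>, then \<open>J x\<close> is
    \<open>norm (A x - h)\<close> squared minus \<open>norm h\<close> squared, so minimising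
    \<open>J\<close> approximates \<open>h\<close> from the range of \<open>A\<close>.\<close>
  define J where "J x = (norm (A x))\<^sup>2 - 2 * Re (\<phi> x)" for x
  have "J x \<ge> - (C\<^sup>2)" for x
  proof -
    have "0 \<le> (norm (A x) - C)\<^sup>2" by simp
    then have "2 * (C * norm (A x)) \<le> (norm (A x))\<^sup>2 + C\<^sup>2"
      by (simp add: power2_diff mult_ac)
    moreover have "Re (\<phi> x) \<le> C * norm (A x)"
      using complex_Re_le_cmod[of "\<phi> x"] C[of x] by linarith
    ultimately show ?thesis by (simp add: J_def)
  qed
  then have bdd: "bdd_below (range J)" by (auto simp: bdd_below_def)
  define m where "m = Inf (range J)"
  have m_le: "m \<le> J x" for x
    unfolding m_def using bdd by (simp add: cInf_lower)
  have "\<exists>x. J x < m + inverse (real (Suc n))" for n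
  proof -
    have "Inf (range J) < m + inverse (real (Suc n))" by (simp add: m_def)
    then show ?thesis by (subst (asm) cInf_less_iff) (use bdd in auto)
  qed
  then obtain X where X: "\<And>n. J (X n) < m + inverse (real (Suc n))" by metis
  have J_lim: "(\<lambda>n. J (X n)) \<longlonglongrightarrow> m"
  proof (rule real_tendsto_sandwich[where f = "\<lambda>_. m"])
    show "(\<lambda>n. m + inverse (real (Suc n))) \<longlonglongrightarrow> m"
      using tendsto_add[OF tendsto_const LIMSEQ_inverse_real_of_nat, of m] by simp
  qed (simp_all del: of_nat_Suc add: m_le less_imp_le[OF X])
  \<comment> \<open>Parallelogram law for \<open>A x\<close> and \<open>A y\<close>: at the midpoint
    \<open>z\<close> the value of \<open>J\<close> is still at least \<open>m\<close>.\<close>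
  have midpoint: "(norm (A x - A y))\<^sup>2 \<le> 2 * (J x - m) + 2 * (J y - m)" for x y
  proof -
    define z where "z = (1/2) *\<^sub>C (x + y)"
    have "norm (A (x + y)) = 2 * norm (A z)"
      by (simp add: z_def A_scale norm_scaleC norm_divide)
    then have "(norm (A x + A y))\<^sup>2 = 4 * (norm (A z))\<^sup>2"
      by (simp add: A_add power_mult_distrib)
    moreover have "\<phi> x + \<phi> y = 2 * \<phi> z"
      by (simp add: z_def \<phi>_scale \<phi>_add)
    then have "Re (\<phi> x) + Re (\<phi> y) = 2 * Re (\<phi> z)"
      by (metis mult_2 plus_complex.simps(1))
    ultimately show ?thesis
      using parallelogram[of "A x" "A y"] m_le[of z] by (simp add: J_def)
  qed
  \<comment> \<open>Two values of \<open>J\<close> within \<open>e\<^sup>2 / 4\<close> of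
    \<open>m\<close> make the right side of \<open>midpoint\<close> smaller than
    \<open>e\<^sup>2\<close>.\<close>
  have "Cauchy (\<lambda>n. A (X n))"
  proof (rule CauchyI)
    fix e :: real assume e: "e > 0"
    then have "\<forall>\<^sub>F n in sequentially. J (X n) < m + e\<^sup>2 / 4"
      using order_tendstoD(2)[OF J_lim, of "m + e\<^sup>2 / 4"] by simp
    then obtain N where N: "\<And>n. n \<ge> N \<Longrightarrow> J (X n) < m + e\<^sup>2 / 4"
      by (auto simp: eventually_sequentially)
    have "norm (A (X n) - A (X k)) < e" if "n \<ge> N" "k \<ge> N" for n k
      using midpoint[of "X n" "X k"] N[OF that(1)] N[OF that(2)] e
      by (intro power2_less_imp_less[of _ e]) auto
    then show "\<exists>N. \<forall>n\<ge>N. \<forall>k\<ge>N. norm (A (X n) - A (X k)) < e" by blast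
  qed
  then obtain h where h: "(\<lambda>n. A (X n)) \<longlonglongrightarrow> h"
    using Cauchy_convergent convergent_def by blast
  \<comment> \<open>Expand \<open>J\<close> at \<open>X n\<close> perturbed by a real multiple
    \<open>t\<close> of \<open>x\<close>, bound it below by \<open>m\<close>, and let
    \<open>n\<close> tend to infinity.\<close>
  have variation: "0 \<le> 2 * t * Re (cinner (A x) h - \<phi> x) + t\<^sup>2 * (norm (A x))\<^sup>2" for t x
  proof -
    have "J (X n) + 2 * t * Re (cinner (A x) (A (X n)) - \<phi> x) + t\<^sup>2 * (norm (A x))\<^sup>2
        = J (complex_of_real t *\<^sub>C x + X n)" for n
      using norm_add_sqr[of "complex_of_real t *\<^sub>C A x" "A (X n)"]
      by (simp add: J_def A_add A_scale \<phi>_add \<phi>_scale cinner_scaleC_left norm_scaleC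
          power_mult_distrib algebra_simps)
    then have "m \<le> J (X n) + 2 * t * Re (cinner (A x) (A (X n)) - \<phi> x) + t\<^sup>2 * (norm (A x))\<^sup>2" for n
      using m_le by simp
    moreover have "(\<lambda>n. J (X n) + 2 * t * Re (cinner (A x) (A (X n)) - \<phi> x) + t\<^sup>2 * (norm (A x))\<^sup>2)
        \<longlonglongrightarrow> m + 2 * t * Re (cinner (A x) h - \<phi> x) + t\<^sup>2 * (norm (A x))\<^sup>2"
      by (intro tendsto_intros J_lim tendsto_cinner_right h)
    ultimately have "m \<le> m + 2 * t * Re (cinner (A x) h - \<phi> x) + t\<^sup>2 * (norm (A x))\<^sup>2"
      by (intro LIMSEQ_le_const) auto
    then show ?thesis by simp
  qed
  have Re_eq: "Re (cinner (A x) h) = Re (\<phi> x)" for x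
  proof (rule ccontr)
    \<comment> \<open>A nonzero linear coefficient \<open>b\<close> makes the quadratic negative at
      \<open>t = - b / q\<close>. The summand 1 keeps \<open>q\<close> positive even if
      \<open>A x = 0\<close>.\<close>
    define b where "b = Re (cinner (A x) h - \<phi> x)"
    define q where "q = (norm (A x))\<^sup>2 + 1"
    assume "Re (cinner (A x) h) \<noteq> Re (\<phi> x)"
    then have b: "b \<noteq> 0" by (simp add: b_def)
    have q: "q > 0" unfolding q_def by (simp add: add_nonneg_pos)
    have "0 \<le> 2 * (- b / q) * b + (- b / q)\<^sup>2 * (norm (A x))\<^sup>2"
      using variation[of "- b / q" x] by (simp add: b_def)
    also have "\<dots> \<le> 2 * (- b / q) * b + (- b / q)\<^sup>2 * q"
      by (intro add_left_mono mult_left_mono) (simp_all add: q_def)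
    also have "\<dots> = - (b\<^sup>2 / q)"
      using q by (simp add: field_simps power2_eq_square)
    also have "\<dots> < 0" using b q by simp
    finally show False by simp
  qed
  have eq: "\<phi> x = cinner (A x) h" for x
  proof (rule complex_eqI)
    show "Re (\<phi> x) = Re (cinner (A x) h)" by (simp add: Re_eq)
    \<comment> \<open>Multiplication by \<open>\<i>\<close> turns the imaginary part into minus the
      real part.\<close>
    show "Im (\<phi> x) = Im (cinner (A x) h)"
      using Re_eq[of "\<i> *\<^sub>C x"] by (simp add: A_scale \<phi>_scale cinner_scaleC_left)
  qed
  moreover have "h \<in> closure (range A)"
    using h unfolding closure_sequential by (intro exI[of _ "\<lambda>n. A (X n)"]) simp
  moreover have "norm h \<le> \<bar>C\<bar>"
  proof -
    \<comment> \<open>The hypothesis along \<open>X n\<close> becomes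
      \<open>norm h * norm h \<le> C * norm h\<close> in the limit.\<close>
    have "(\<lambda>n. cmod (\<phi> (X n))) \<longlonglongrightarrow> cmod (cinner h h)"
      unfolding eq by (intro tendsto_norm tendsto_cinner_left h)
    moreover have "(\<lambda>n. C * norm (A (X n))) \<longlonglongrightarrow> C * norm h"
      by (intro tendsto_intros h)
    ultimately have "cmod (cinner h h) \<le> C * norm h"
      using C by (intro LIMSEQ_le) auto
    then have "norm h * norm h \<le> C * norm h"
      by (simp add: cinner_self norm_mult power2_eq_square)
    then show ?thesis
      by (cases "h = 0") auto
  qed
  ultimately show ?thesis using that by blast
qed

section \<open>Weak continuity and norm continuity\<close>

text \<open>The generators are preimages of open sets under bounded functionals, hence norm open,
  and the generated topology is the coarsest one containing them.\<close>

lemma weak_topology_open: "openin weak_topology S \<Longrightarrow> open (S :: 'h::complex_inner set)"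
  unfolding weak_topology_def induced_topology_def openin_topology_generated_by_iff
  by (erule generate_topology_on_coarsest[rotated 2])
    (auto intro!: open_vimage linear_continuous_on bounded_clinear_imp_bounded_linear
      simp: istopology_open)

text \<open>Makes weak continuity usable for Riesz: sets generating \<open>sigma_left pair\<close>
  pull back under \<open>T\<close> to weakly open, hence norm open, sets.\<close>

lemma weak_operators_continuous_functional:
  fixes T :: "'h::chilbert_space \<Rightarrow> 'f::complex_vector"
  assumes "T \<in> weak_operators pair"
  shows "continuous_on UNIV (\<lambda>h. pair (T h) x)"
proof -
  have "open ((\<lambda>h. pair (T h) x) -` U)" if "open U" for U
  proof -
    have "openin (sigma_left pair) ((\<lambda>f. pair f x) -` U)"
      unfolding sigma_left_def induced_topology_def
      by (rule topology_generated_by_Basis) (use that in blast)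
    then have "openin weak_topology (T -` (\<lambda>f. pair f x) -` U \<inter> topspace weak_topology)"
      using assms by (auto simp: weak_operators_def continuous_map_alt)
    \<comment> \<open>Preimages come intersected with the carrier of the weak topology. It is the
      whole space, since the zero functional pulls the plane back to everything.\<close>
    moreover have "topspace (weak_topology :: 'h topology) = UNIV"
    proof -
      have "bounded_clinear (\<lambda>h::'h. 0::complex)"
        by (auto simp: bounded_clinear_def clinear_iff scaleC_complex_def intro: exI[of _ 0])
      then show ?thesis
        by (auto simp: weak_topology_def induced_topology_def)
    qed
    ultimately show ?thesis
      by (auto dest: weak_topology_open simp: vimage_def)
  qed
  then show ?thesis by (simp add: continuous_on_open_vimage)
qed

section \<open>Adjoints and preimages of weakly continuous operators\<close>

context anti_dual_pair
begin

lemma zero_left [simp]: "pair 0 x = 0"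
  using add_left[of 0 0 x] by simp

lemma left_eqI: "(\<And>x. pair f x = pair g x) \<Longrightarrow> f = g"
  using separates_left by blast

lemma clinear_cnj_pair: "clinear (\<lambda>x. cnj (pair f x))"
  by (simp add: clinear_iff add_right scaleC_right scaleC_complex_def)

text \<open>For each \<open>x\<close> the functional \<open>h \<mapsto> pair (T h) x\<close> is
  bounded, so Riesz with \<open>A = id\<close> represents it by a vector \<open>S x\<close>. Both
  forms are conjugate linear in the second variable, so \<open>S\<close> is linear and is the map
  described in \<open>weak_adjoint\<close>.\<close>

lemma weak_adjoint:
  fixes T :: "'h::chilbert_space \<Rightarrow> 'f"
  assumes T: "T \<in> weak_operators pair"
  shows "pair (T h) x = cinner h (weak_adjoint pair T x)"
    and "clinear (weak_adjoint pair T)"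
proof -
  have lin: "clinear T" using T by (simp add: weak_operators_def)
  have fun_lin: "clinear (\<lambda>h. pair (T h) x)" for x
    using lin by (simp add: clinear_iff add_left scaleC_left scaleC_complex_def)
  have "\<exists>y. \<forall>h. pair (T h) x = cinner h y" for x
  proof -
    let ?\<phi> = "\<lambda>h. pair (T h) x"
    have "linear ?\<phi>"
      using fun_lin[of x] by (intro linearI) (auto simp: clinear_iff scaleR_scaleC)
    moreover have "continuous (at 0) ?\<phi>"
      using weak_operators_continuous_functional[OF T, of x]
      by (simp add: continuous_on_eq_continuous_at)
    ultimately have "bounded_linear ?\<phi>"
      by (rule bounded_linear_if_continuous_at_0)
    then obtain K where K: "\<And>h. cmod (?\<phi> h) \<le> norm h * K"
      using bounded_linear.bounded by blast
    have "clinear (id :: 'h \<Rightarrow> 'h)" by (simp add: clinear_iff)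
    then obtain y where "\<And>h. ?\<phi> h = cinner (id h) y"
      by (rule riesz_along_operator[OF _ fun_lin[of x], of id K]) (use K in \<open>auto simp: mult.commute\<close>)
    then show ?thesis by auto
  qed
  then obtain S where S: "\<And>h x. pair (T h) x = cinner h (S x)"
    by metis
  have cinner_eqI: "y = z" if "\<And>h. cinner h y = cinner h z" for y z :: 'h
    using that[of "y - z"] cinner_diff_right[of "y - z" y z]
    by (simp add: cinner_eq_zero_iff)
  have "clinear S"
    unfolding clinear_iff
    by (auto intro!: cinner_eqI simp: cinner_add_right cinner_scaleC_right add_right scaleC_right
        S[symmetric])
  moreover from this S have "weak_adjoint pair T = S"
    by (rule weak_adjoint_eqI)
  ultimately show "pair (T h) x = cinner h (weak_adjoint pair T x)"
    and "clinear (weak_adjoint pair T)"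
    using S by auto
qed

lemma clinear_weak_operator: "T \<in> weak_operators pair \<Longrightarrow> clinear T"
  by (simp add: weak_operators_def)

text \<open>The product of \<open>weak_adjoint pair T x\<close> with \<open>k\<close> is the
  conjugate of \<open>pair (T k) x\<close>, which vanishes on the kernel; an orthogonal complement
  is closed.\<close>

lemma closure_range_weak_adjoint:
  fixes T :: "'h::chilbert_space \<Rightarrow> 'f"
  assumes T: "T \<in> weak_operators pair"
  shows "closure (range (weak_adjoint pair T)) \<subseteq> ortho_compl (ker T)"
proof (rule closure_minimal)
  have "cinner (weak_adjoint pair T x) k = 0" if "T k = 0" for x k
    using weak_adjoint(1)[OF T, of k x] that cinner_commute[of "weak_adjoint pair T x" k] by simp
  then show "range (weak_adjoint pair T) \<subseteq> ortho_compl (ker T)"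
    by (auto simp: ortho_compl_def ker_def)
  have "ortho_compl (ker T) = (\<Inter>k\<in>ker T. {h. cinner h k = 0})"
    by (auto simp: ortho_compl_def)
  moreover have "closed {h. cinner h k = 0}" for k :: 'h
    by (intro closed_Collect_eq linear_continuous_on bounded_linear_cinner_left continuous_on_const)
  ultimately show "closed (ortho_compl (ker T))" by auto
qed

text \<open>The difference of two such vectors with equal image lies in the kernel and is orthogonal
  to it, hence to itself.\<close>

lemma inj_on_ortho_compl_ker:
  fixes T :: "'h::chilbert_space \<Rightarrow> 'f"
  assumes "clinear T"
  shows "inj_on T (ortho_compl (ker T))"
proof (rule inj_onI)
  fix h k assume hk: "h \<in> ortho_compl (ker T)" "k \<in> ortho_compl (ker T)" and "T h = T k"
  moreover have "T h = T (h - k) + T k"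
    using assms by (metis clinear_iff diff_add_cancel)
  ultimately have "h - k \<in> ker T" by (simp add: ker_def)
  with hk have "cinner h (h - k) = 0" "cinner k (h - k) = 0"
    by (auto simp: ortho_compl_def)
  then have "cinner (h - k) (h - k) = 0"
    by (simp add: cinner_diff_left)
  then show "h = k" by (simp add: cinner_eq_zero_iff)
qed

text \<open>Riesz along the adjoint, applied to the conjugate of \<open>pair f\<close>, since
  \<open>pair f\<close> itself is conjugate linear. The resulting \<open>T h\<close> and
  \<open>f\<close> pair equally with every \<open>x\<close>.\<close>

lemma weak_operator_preimage:
  fixes T :: "'h::chilbert_space \<Rightarrow> 'f"
  assumes T: "T \<in> weak_operators pair"
    and C: "\<And>x. cmod (pair f x) \<le> C * norm (weak_adjoint pair T x)"
  obtains h where "h \<in> ortho_compl (ker T)" "T h = f" "norm h \<le> \<bar>C\<bar>"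
proof -
  obtain h where h: "h \<in> closure (range (weak_adjoint pair T))" "norm h \<le> \<bar>C\<bar>"
    and eq: "\<And>x. cnj (pair f x) = cinner (weak_adjoint pair T x) h"
    by (rule riesz_along_operator[OF weak_adjoint(2)[OF T] clinear_cnj_pair[of f], of C])
      (use C in auto)
  have "pair (T h) x = pair f x" for x
    using weak_adjoint(1)[OF T] eq cinner_commute by (metis complex_cnj_cnj)
  then have "T h = f" by (rule left_eqI)
  with h closure_range_weak_adjoint[OF T] that show ?thesis by blast
qed

lemma cmod_pair_le:
  fixes T :: "'h::chilbert_space \<Rightarrow> 'f"
  assumes "T \<in> weak_operators pair"
  shows "cmod (pair (T h) x) \<le> norm h * norm (weak_adjoint pair T x)"
  using weak_adjoint(1)[OF assms] cinner_cauchy_schwarz by metis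

section \<open>From pointwise to uniform domination\<close>

lemma weak_adjoint_dominated:
  fixes T1 :: "'h1::chilbert_space \<Rightarrow> 'f" and T2 :: "'h2::chilbert_space \<Rightarrow> 'f"
  assumes T1: "T1 \<in> weak_operators pair" and T2: "T2 \<in> weak_operators pair"
    and pointwise: "\<And>h. \<exists>C. \<forall>x. cmod (pair (T1 h) x) \<le> C * norm (weak_adjoint pair T2 x)"
  obtains C where "C \<ge> 0" "\<And>x. norm (weak_adjoint pair T1 x) \<le> C * norm (weak_adjoint pair T2 x)"
proof -
  let ?S1 = "weak_adjoint pair T1" and ?S2 = "weak_adjoint pair T2"
  \<comment> \<open>Normalising by \<open>r * norm (?S2 x) \<le> 1\<close> instead of dividing keeps
    every \<open>x\<close> with \<open>?S2 x = 0\<close> in the family, there with arbitrary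
    \<open>r \<ge> 0\<close>.\<close>
  define \<F> where "\<F> = (\<lambda>(r, x) h. r *\<^sub>R cinner h (?S1 x)) ` {(r, x). r \<ge> 0 \<and> r * norm (?S2 x) \<le> 1}"
  obtain C where C: "C \<ge> 0" "\<And>f h. f \<in> \<F> \<Longrightarrow> norm (f h) \<le> C * norm h"
  proof (rule uniform_boundedness[of \<F>])
    show "bounded_linear f" if "f \<in> \<F>" for f
      using that unfolding \<F>_def
      by (auto intro!: bounded_linear_compose[OF bounded_linear_scaleR_right] bounded_linear_cinner_left)
    show "\<exists>C. \<forall>f\<in>\<F>. norm (f h) \<le> C" for h
    proof -
      obtain C where C: "\<And>x. cmod (pair (T1 h) x) \<le> C * norm (?S2 x)"
        using pointwise by blast
      have "norm (r *\<^sub>R cinner h (?S1 x)) \<le> \<bar>C\<bar>" if r: "r \<ge> 0" "r * norm (?S2 x) \<le> 1" for r x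
      proof -
        have "cmod (cinner h (?S1 x)) \<le> \<bar>C\<bar> * norm (?S2 x)"
          using C[of x] weak_adjoint(1)[OF T1, of h x] mult_right_mono[OF abs_ge_self norm_ge_zero, of C "?S2 x"]
          by simp
        then have "r * cmod (cinner h (?S1 x)) \<le> \<bar>C\<bar> * (r * norm (?S2 x))"
          using r(1) by (metis mult.left_commute mult_left_mono)
        also have "\<dots> \<le> \<bar>C\<bar> * 1" using r(2) by (intro mult_left_mono) auto
        finally show ?thesis using r(1) by simp
      qed
      then show ?thesis by (auto simp: \<F>_def)
    qed
  qed blast
  have "norm (?S1 x) \<le> C * norm (?S2 x)" for x
  proof -
    have *: "r * norm (?S1 x) \<le> C" if r: "r \<ge> 0" "r * norm (?S2 x) \<le> 1" for r
    proof (cases "?S1 x = 0")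
      case False
      \<comment> \<open>The uniform bound is tested at \<open>h = ?S1 x\<close>.\<close>
      have "norm (r *\<^sub>R cinner (?S1 x) (?S1 x)) \<le> C * norm (?S1 x)"
        by (rule C) (use r in \<open>auto simp: \<F>_def\<close>)
      then have "(r * norm (?S1 x)) * norm (?S1 x) \<le> C * norm (?S1 x)"
        using r(1) by (simp add: cinner_self norm_mult power2_eq_square mult.assoc)
      then show ?thesis using False by simp
    qed (use C(1) in simp)
    show ?thesis
    proof (cases "?S2 x = 0")
      case True
      have "norm (?S1 x) = 0"
      proof (rule ccontr)
        assume "norm (?S1 x) \<noteq> 0"
        \<comment> \<open>Here every \<open>r \<ge> 0\<close> is allowed, and this one would give
          \<open>C + 1 \<le> C\<close>.\<close>
        then show False
          using *[of "(C + 1) / norm (?S1 x)"] True C(1) by simp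
      qed
      then show ?thesis by (simp add: True)
    next
      case False
      then show ?thesis
        using *[of "1 / norm (?S2 x)"] by (simp add: field_simps)
    qed
  qed
  with C(1) that show ?thesis by blast
qed

section \<open>The factor and its norm\<close>

text \<open>Each \<open>T1 h\<close> is dominated with constant \<open>C * norm h\<close>, so
  \<open>weak_operator_preimage\<close> supplies a value \<open>D h\<close> of norm at most
  \<open>C * norm h\<close>.\<close>

lemma douglas_factor:
  fixes T1 :: "'h1::chilbert_space \<Rightarrow> 'f" and T2 :: "'h2::chilbert_space \<Rightarrow> 'f"
  assumes T1: "T1 \<in> weak_operators pair" and T2: "T2 \<in> weak_operators pair"
    and C: "\<And>x. norm (weak_adjoint pair T1 x) \<le> C * norm (weak_adjoint pair T2 x)" "C \<ge> 0"
  obtains D where "bounded_clinear D" "T1 = T2 \<circ> D" "range D \<subseteq> ortho_compl (ker T2)"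
    "\<And>h. norm (D h) \<le> C * norm h"
proof -
  have "\<exists>k. k \<in> ortho_compl (ker T2) \<and> T2 k = T1 h \<and> norm k \<le> C * norm h" for h
  proof -
    have "cmod (pair (T1 h) x) \<le> C * norm h * norm (weak_adjoint pair T2 x)" for x
      using cmod_pair_le[OF T1, of h x] mult_left_mono[OF C(1)[of x], of "norm h"]
      by (simp add: mult_ac)
    then show ?thesis
      using weak_operator_preimage[OF T2, of "T1 h" "C * norm h"] C(2)
      by (metis abs_of_nonneg mult_nonneg_nonneg norm_ge_zero)
  qed
  then obtain D where D: "\<And>h. D h \<in> ortho_compl (ker T2)" "\<And>h. T2 (D h) = T1 h"
    "\<And>h. norm (D h) \<le> C * norm h"
    by metis
  \<comment> \<open>Preimages in the complement are unique, so linearity of \<open>D\<close> reduces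
    to checking membership and image of the expected value.\<close>
  have D_eqI: "D h = k" if "k \<in> ortho_compl (ker T2)" "T2 k = T1 h" for h k
    using inj_onD[OF inj_on_ortho_compl_ker[OF clinear_weak_operator[OF T2]]] that D by metis
  have "clinear D"
    unfolding clinear_iff
  proof (intro conjI allI)
    show "D (h + k) = D h + D k" for h k
    proof (rule D_eqI)
      show "D h + D k \<in> ortho_compl (ker T2)"
        using D(1)[of h] D(1)[of k] by (simp add: ortho_compl_def cinner_add_left)
      show "T2 (D h + D k) = T1 (h + k)"
        using clinear_weak_operator[OF T1] clinear_weak_operator[OF T2] D(2)
        by (simp add: clinear_iff)
    qed
    show "D (a *\<^sub>C h) = a *\<^sub>C D h" for a h
    proof (rule D_eqI)
      show "a *\<^sub>C D h \<in> ortho_compl (ker T2)"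
        using D(1)[of h] by (simp add: ortho_compl_def cinner_scaleC_left)
      show "T2 (a *\<^sub>C D h) = T1 (a *\<^sub>C h)"
        using clinear_weak_operator[OF T1] clinear_weak_operator[OF T2] D(2)
        by (simp add: clinear_iff)
    qed
  qed
  then have "bounded_clinear D" using D(3) by (auto simp: bounded_clinear_def)
  moreover have "T1 = T2 \<circ> D" using D(2) by auto
  ultimately show ?thesis using that D by blast
qed

text \<open>For \<open>y = weak_adjoint pair T1 x\<close>, the square of \<open>norm y\<close> is
  \<open>pair (T2 (D y)) x\<close>, the product of \<open>D y\<close> with
  \<open>weak_adjoint pair T2 x\<close>. Cauchy-Schwarz applies, and one factor
  \<open>norm y\<close> cancels.\<close>

lemma weak_adjoint_le_onorm:
  fixes T1 :: "'h1::chilbert_space \<Rightarrow> 'f" and T2 :: "'h2::chilbert_space \<Rightarrow> 'f"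
  assumes T1: "T1 \<in> weak_operators pair" and T2: "T2 \<in> weak_operators pair"
    and D: "bounded_clinear D" "T1 = T2 \<circ> D"
  shows "norm (weak_adjoint pair T1 x) \<le> onorm D * norm (weak_adjoint pair T2 x)"
proof (cases "weak_adjoint pair T1 x = 0")
  case True
  then show ?thesis
    using onorm_pos_le[OF bounded_clinear_imp_bounded_linear[OF D(1)]] by simp
next
  case False
  let ?y = "weak_adjoint pair T1 x" and ?z = "weak_adjoint pair T2 x"
  have "cinner ?y ?y = cinner (D ?y) ?z"
    using weak_adjoint(1)[OF T1, of ?y x] weak_adjoint(1)[OF T2, of "D ?y" x] D(2) by simp
  then have "norm ?y * norm ?y \<le> norm (D ?y) * norm ?z"
    using cinner_cauchy_schwarz[of "D ?y" ?z]
    by (metis cinner_self norm_of_real abs_power2 power2_eq_square)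
  also have "\<dots> \<le> onorm D * norm ?y * norm ?z"
    by (intro mult_right_mono onorm bounded_clinear_imp_bounded_linear D(1) norm_ge_zero)
  finally show ?thesis using False by (simp add: mult_ac)
qed

end

section \<open>The equivalences and the least constant\<close>

lemma power2_le_iff_le_sqrt:
  fixes a b \<alpha> :: real
  assumes "a \<ge> 0" "b \<ge> 0" "\<alpha> \<ge> 0"
  shows "a\<^sup>2 \<le> \<alpha> * b\<^sup>2 \<longleftrightarrow> a \<le> sqrt \<alpha> * b"
proof -
  have "\<alpha> * b\<^sup>2 = (sqrt \<alpha> * b)\<^sup>2" using assms by (simp add: power_mult_distrib)
  then show ?thesis using assms by (simp add: abs_le_square_iff[symmetric])
qed

theorem theorem2p1:
  fixes pair :: "'f::complex_vector \<Rightarrow> 'e::complex_vector \<Rightarrow> complex"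
    and T1 :: "'h1::chilbert_space \<Rightarrow> 'f"
    and T2 :: "'h2::chilbert_space \<Rightarrow> 'f"
  assumes "anti_dual_pair pair"
    and "T1 \<in> weak_operators pair"
    and "T2 \<in> weak_operators pair"
  shows
    "let
       T1s = weak_adjoint pair T1;
       T2s = weak_adjoint pair T2;
       c1 = (range T1 \<subseteq> range T2);
       c2 = (\<exists>\<alpha>\<ge>0. \<forall>x. (norm (T1s x))\<^sup>2 \<le> \<alpha> * (norm (T2s x))\<^sup>2);
       c3 = (\<forall>h. \<exists>\<alpha>\<ge>0. \<forall>x. (cmod (pair (T1 h) x))\<^sup>2 \<le> \<alpha> * (norm (T2s x))\<^sup>2);
       c4 = (\<exists>D :: 'h1 \<Rightarrow> 'h2. bounded_clinear D \<and> T1 = T2 \<circ> D)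
     in
       (c1 \<longleftrightarrow> c2) \<and> (c2 \<longleftrightarrow> c3) \<and> (c3 \<longleftrightarrow> c4) \<and>
       (c1 \<or> c2 \<or> c3 \<or> c4 \<longrightarrow>
         (\<exists>!D :: 'h1 \<Rightarrow> 'h2.
            bounded_clinear D \<and> T1 = T2 \<circ> D \<and>
            range D \<subseteq> ortho_compl (ker T2) \<and>
            ker T1 = ker D \<and>
            (onorm D)\<^sup>2 =
              Inf {\<alpha>. \<alpha> \<ge> 0 \<and> (\<forall>x. (norm (T1s x))\<^sup>2 \<le> \<alpha> * (norm (T2s x))\<^sup>2)}))"
proof -
  interpret anti_dual_pair pair by fact
  note T1 = assms(2) and T2 = assms(3)
  let ?S1 = "weak_adjoint pair T1" and ?S2 = "weak_adjoint pair T2"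
  define c1 where "c1 = (range T1 \<subseteq> range T2)"
  define c2 where "c2 = (\<exists>\<alpha>\<ge>0. \<forall>x. (norm (?S1 x))\<^sup>2 \<le> \<alpha> * (norm (?S2 x))\<^sup>2)"
  define c3 where "c3 = (\<forall>h. \<exists>\<alpha>\<ge>0. \<forall>x. (cmod (pair (T1 h) x))\<^sup>2 \<le> \<alpha> * (norm (?S2 x))\<^sup>2)"
  define c4 where "c4 = (\<exists>D :: 'h1 \<Rightarrow> 'h2. bounded_clinear D \<and> T1 = T2 \<circ> D)"
  define B where "B = {\<alpha>. \<alpha> \<ge> 0 \<and> (\<forall>x. (norm (?S1 x))\<^sup>2 \<le> \<alpha> * (norm (?S2 x))\<^sup>2)}"
  define good where "good D \<longleftrightarrow> bounded_clinear D \<and> T1 = T2 \<circ> D \<and> range D \<subseteq> ortho_compl (ker T2) \<and>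
    ker T1 = ker D \<and> (onorm D)\<^sup>2 = Inf B" for D :: "'h1 \<Rightarrow> 'h2"
  have B_iff: "\<alpha> \<in> B \<longleftrightarrow> \<alpha> \<ge> 0 \<and> (\<forall>x. norm (?S1 x) \<le> sqrt \<alpha> * norm (?S2 x))" for \<alpha>
    by (auto simp: B_def power2_le_iff_le_sqrt)
  have c2_iff: "c2 \<longleftrightarrow> B \<noteq> {}"
    by (auto simp: c2_def B_def)
  \<comment> \<open>Serves twice: for the final uniqueness claim, and to identify the factors
    obtained from different constants in \<open>B\<close>.\<close>
  have unique: "D = D'" if D: "T1 = T2 \<circ> D" "range D \<subseteq> ortho_compl (ker T2)"
    and D': "T1 = T2 \<circ> D'" "range D' \<subseteq> ortho_compl (ker T2)" for D D'
  proof
    fix h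
    have "T2 (D h) = T2 (D' h)" using D(1) D'(1) by (metis comp_apply)
    then show "D h = D' h"
      using inj_onD[OF inj_on_ortho_compl_ker[OF clinear_weak_operator[OF T2]]] D(2) D'(2) by blast
  qed
  \<comment> \<open>The cycle runs \<open>c1\<close>, \<open>c3\<close>, \<open>c2\<close>,
    \<open>c4\<close>, \<open>c1\<close>.\<close>
  have "c3" if "c1"
    unfolding c3_def
  proof
    fix h
    have "T1 h \<in> range T2" using that unfolding c1_def by blast
    then obtain k where "T1 h = T2 k" by blast
    then have "cmod (pair (T1 h) x) \<le> sqrt ((norm k)\<^sup>2) * norm (?S2 x)" for x
      using cmod_pair_le[OF T2, of k x] by simp
    then show "\<exists>\<alpha>\<ge>0. \<forall>x. (cmod (pair (T1 h) x))\<^sup>2 \<le> \<alpha> * (norm (?S2 x))\<^sup>2"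
      by (intro exI[of _ "(norm k)\<^sup>2"]) (simp add: power2_le_iff_le_sqrt)
  qed
  moreover have "c2" if "c3"
  proof -
    have "\<exists>C. \<forall>x. cmod (pair (T1 h) x) \<le> C * norm (?S2 x)" for h
      using that unfolding c3_def by (metis power2_le_iff_le_sqrt norm_ge_zero)
    then obtain C where "C \<ge> 0" "\<And>x. norm (?S1 x) \<le> C * norm (?S2 x)"
      using weak_adjoint_dominated[OF T1 T2] by blast
    then have "C\<^sup>2 \<in> B" by (simp add: B_iff)
    then show ?thesis by (auto simp: c2_iff)
  qed
  moreover have ex: "\<exists>D. good D" if "c2"
  proof -
    \<comment> \<open>Stated for every \<open>\<alpha>\<close> in \<open>B\<close>: by
      \<open>unique\<close> all these factors coincide, so a single \<open>D\<close> obeys every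
      bound \<open>sqrt \<alpha>\<close>.\<close>
    have factor: "\<exists>D. bounded_clinear D \<and> T1 = T2 \<circ> D \<and> range D \<subseteq> ortho_compl (ker T2) \<and>
        (\<forall>h. norm (D h) \<le> sqrt \<alpha> * norm h)" if "\<alpha> \<in> B" for \<alpha>
      using that douglas_factor[OF T1 T2, of "sqrt \<alpha>"] unfolding B_iff
      by (metis real_sqrt_ge_zero)
    then obtain D where D: "bounded_clinear D" "T1 = T2 \<circ> D" "range D \<subseteq> ortho_compl (ker T2)"
      using \<open>c2\<close> c2_iff by blast
    note blin = bounded_clinear_imp_bounded_linear[OF D(1)]
    have zero: "T2 0 = 0" "D 0 = 0"
      using clinear_weak_operator[OF T2] D(1)
      by (auto simp: bounded_clinear_def Vector_Spaces.linear.axioms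
          module_hom.zero[OF Vector_Spaces.linear.axioms(3)])
    have "D h = 0" if "T1 h = 0" for h
    proof (rule inj_onD[OF inj_on_ortho_compl_ker[OF clinear_weak_operator[OF T2]]])
      show "T2 (D h) = T2 0" using that D(2) zero by (metis comp_apply)
      show "D h \<in> ortho_compl (ker T2)" using D(3) by blast
      show "0 \<in> ortho_compl (ker T2)" by (simp add: ortho_compl_def)
    qed
    then have "ker T1 = ker D"
      using D(2) zero by (auto simp: ker_def)
    moreover have "(onorm D)\<^sup>2 = Inf B"
    \<comment> \<open>The infimum is attained: the squared norm of \<open>D\<close> is itself an
      admissible constant and lies below all others.\<close>
    proof (rule cInf_eq_minimum[symmetric])
      show "(onorm D)\<^sup>2 \<in> B"
        using weak_adjoint_le_onorm[OF T1 T2 D(1,2)] onorm_pos_le[OF blin] by (simp add: B_iff)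
      fix \<alpha> assume \<alpha>: "\<alpha> \<in> B"
      then obtain D' where "T1 = T2 \<circ> D'" "range D' \<subseteq> ortho_compl (ker T2)"
        and "\<And>h. norm (D' h) \<le> sqrt \<alpha> * norm h"
        using factor by blast
      with unique[OF D(2,3)] have "\<And>h. norm (D h) \<le> sqrt \<alpha> * norm h" by blast
      then have "onorm D \<le> sqrt \<alpha>"
        using \<alpha> by (intro onorm_bound) (auto simp: B_iff)
      then have "(onorm D)\<^sup>2 \<le> (sqrt \<alpha>)\<^sup>2"
        by (intro power_mono onorm_pos_le blin)
      then show "(onorm D)\<^sup>2 \<le> \<alpha>" using \<alpha> by (simp add: B_iff)
    qed
    ultimately show ?thesis using D by (auto simp: good_def)
  qed
  moreover have "c4" if "c2"
    using ex[OF that] by (auto simp: c4_def good_def)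
  moreover have "c1" if "c4"
    using that by (auto simp: c1_def c4_def)
  ultimately have equiv: "(c1 \<longleftrightarrow> c2) \<and> (c2 \<longleftrightarrow> c3) \<and> (c3 \<longleftrightarrow> c4)"
    by blast
  moreover have "c1 \<or> c2 \<or> c3 \<or> c4 \<longrightarrow> (\<exists>!D. good D)"
  proof
    assume "c1 \<or> c2 \<or> c3 \<or> c4"
    with equiv have c2 by blast
    then show "\<exists>!D. good D"
      using ex unique unfolding good_def by (intro ex_ex1I) blast+
  qed
  ultimately show ?thesis
    unfolding Let_def c1_def c2_def c3_def c4_def good_def B_def by (simp only: simp_thms)
qed

end
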